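(* For every integer $k \geq 2$, $$\Delta_{\mathbf d}(2^k) = -J_{k+1}\prod_{3\le i\le k} J_i^{2^{k-i}} \qquad\text{and}\qquad \Delta_{\overline{\mathbf d}}(2^k) = J_{k}\prod_{3\le i\le k} J_i^{2^{k-i}},$$ where an empty product equals $1$.
   Context: The period-doubling sequence $\mathbf d=(d_n)_{n\ge 0}=1011101010111011\cdots$ is the fixed point starting with $1$ of the morphism $1\mapsto 10$, $0\mapsto 11$ (equivalently, $d_n=1$ iff the binary digit sums of $n$ and $n+1$ have different parity). Its complement is $\overline{\mathbf d}=(1-d_n)_{n\ge0}$. For a sequence $\mathbf s=(s_n)_{n\ge0}$ and $k\ge1$, the Hankel matrix of order $k$ is $M_{\mathbf s}(k)=(s_{a+b})_{0\le a,b\le k-1}$ and $\Delta_{\mathbf s}(k)=\det M_{\mathbf s}(k)$. The Jacobsthal numbers are $J_n=(2^n-(-1)^n)/3$ for $n\ge0$ (so $J_0=0,J_1=J_2=1,J_3=3,J_4=5,\dots$). *)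

theory Defs
  imports "Jordan_Normal_Form.Determinant"
begin

definition pd_letter :: "int \<Rightarrow> int list" where
  "pd_letter a = (if a = 1 then [1, 0] else [1, 1])"

definition pd_morph :: "int list \<Rightarrow> int list" where
  "pd_morph w = concat (map pd_letter w)"

text \<open>The fixed point is the limit of the iterates of the morphism on the word 1. Each iterate
  is a prefix of the next one, and the n-th has length 2^n > n, so it determines the letter at
  position n. Lemmas \<open>pd_fixed_point\<close> and \<open>pd_unique\<close> below confirm that this is the unique
  fixed point starting with 1.\<close>

definition pd :: "nat \<Rightarrow> int" where
  "pd n = (pd_morph ^^ n) [1] ! n"

definition pd_compl :: "nat \<Rightarrow> int" where
  "pd_compl n = 1 - pd n"

definition hankel_mat :: "(nat \<Rightarrow> int) \<Rightarrow> nat \<Rightarrow> int mat" where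
  "hankel_mat s k = mat k k (\<lambda>(a, b). s (a + b))"

definition hankel_det :: "(nat \<Rightarrow> int) \<Rightarrow> nat \<Rightarrow> int" where
  "hankel_det s k = det (hankel_mat s k)"

text \<open>The division is exact, see \<open>three_jacobsthal\<close>.\<close>

definition jacobsthal :: "nat \<Rightarrow> int" where
  "jacobsthal n = (2 ^ n - (- 1) ^ n) div 3"

lemma three_jacobsthal: "3 * jacobsthal n = 2 ^ n - (- 1) ^ n"
proof -
  have "(3::int) dvd 2 ^ n - (- 1) ^ n"
  proof (induction n)
    case (Suc n)
    have "(2::int) ^ Suc n - (- 1) ^ Suc n = 2 * (2 ^ n - (- 1) ^ n) + 3 * (- 1) ^ n"
      by simp
    then show ?case using Suc by (metis dvd_add dvd_mult dvd_triv_left)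
  qed simp
  then show ?thesis by (simp add: jacobsthal_def)
qed

lemma length_pd_morph: "length (pd_morph w) = 2 * length w"
  by (induction w) (auto simp: pd_morph_def pd_letter_def)

lemma pd_morph_append: "pd_morph (u @ v) = pd_morph u @ pd_morph v"
  by (simp add: pd_morph_def)

lemma length_pd_iterate: "length ((pd_morph ^^ n) [1]) = 2 ^ n"
  by (induction n) (simp_all add: length_pd_morph)

lemma pd_iterate_Suc: "\<exists>v. (pd_morph ^^ Suc n) [1] = (pd_morph ^^ n) [1] @ v"
proof (induction n)
  case 0
  show ?case by (simp add: pd_morph_def pd_letter_def)
next
  case (Suc n)
  then obtain v where "(pd_morph ^^ Suc n) [1] = (pd_morph ^^ n) [1] @ v" by blast
  then have "(pd_morph ^^ Suc (Suc n)) [1] = (pd_morph ^^ Suc n) [1] @ pd_morph v"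
    by (metis comp_apply funpow.simps(2) pd_morph_append)
  then show ?case by blast
qed

lemma pd_iterate_le:
  assumes "m \<le> n" shows "\<exists>v. (pd_morph ^^ n) [1] = (pd_morph ^^ m) [1] @ v"
  using assms
proof (induction rule: dec_induct)
  case (step n)
  then show ?case using pd_iterate_Suc[of n] by (metis append.assoc)
qed simp

lemma pd_iterate_nth:
  assumes "i < 2 ^ n" shows "(pd_morph ^^ n) [1] ! i = pd i"
proof (cases "i \<le> n")
  case True
  then obtain v where "(pd_morph ^^ n) [1] = (pd_morph ^^ i) [1] @ v"
    using pd_iterate_le by blast
  then show ?thesis by (simp add: pd_def nth_append length_pd_iterate)
next
  case False
  then obtain v where "(pd_morph ^^ i) [1] = (pd_morph ^^ n) [1] @ v"
    using pd_iterate_le[of n i] by auto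
  then show ?thesis using assms by (simp add: pd_def nth_append length_pd_iterate)
qed

lemma pd_iterate_eq: "(pd_morph ^^ n) [1] = map pd [0..<2 ^ n]"
  by (rule nth_equalityI) (simp_all add: length_pd_iterate pd_iterate_nth)

lemma pd_0: "pd 0 = 1"
  by (simp add: pd_def)

lemma pd_fixed_point: "pd_morph (map pd [0..<n]) = map pd [0..<2 * n]"
proof -
  have "[0..<2 ^ n] = [0..<n] @ [n..<2 ^ n]"
    using upt_add_eq_append[of 0 n "2 ^ n - n"] less_exp[of n] by simp
  then have "map pd [0..<2 ^ Suc n] = pd_morph (map pd [0..<n]) @ pd_morph (map pd [n..<2 ^ n])"
    using pd_iterate_eq[of n] pd_iterate_eq[of "Suc n"]
    by (metis comp_apply funpow.simps(2) map_append pd_morph_append)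
  then have "pd_morph (map pd [0..<n]) = take (2 * n) (map pd [0..<2 ^ Suc n])"
    by (simp add: length_pd_morph)
  also have "\<dots> = map pd [0..<2 * n]"
    using less_exp[of n] by (simp add: take_map take_upt)
  finally show ?thesis .
qed

lemma pd_unique:
  assumes "s 0 = 1" and "\<And>n. pd_morph (map s [0..<n]) = map s [0..<2 * n]"
  shows "s = pd"
proof -
  have "(pd_morph ^^ n) [1] = map s [0..<2 ^ n]" for n
    by (induction n) (simp_all add: assms)
  then have "s n = pd n" for n
    using less_exp[of n] by (simp add: pd_def)
  then show ?thesis by blast
qed

end

(* Since d(2n) = 1 and d(2n+1) = 1 - d(n), sorting rows and columns by parity turns the Hankel
   matrices of order 2n into [[J, J - D], [J - D, J]] for d and [[0, D], [D, 0]] for its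
   complement, where J is the all-ones matrix and D the Hankel matrix of d of order n. With
   det [[A, B], [B, A]] = det (A + B) det (A - B), the determinants of order 2n become
   det (2J - D) det D and det D det (-D). As det (x J - D) is an affine function of x, the factor
   det (2J - D) equals 2 det (J - D) - det (-D). The result follows by
   induction with the recurrence J_(k+2) = J_(k+1) + 2 J_k for the Jacobsthal numbers. *)

theory Submission
  imports Defs
begin

text \<open>Adding the second block row to the first and then subtracting the first block column
  from the second leaves a block triangular matrix; \<open>?U\<close> and \<open>?V\<close> perform
  these steps and have determinant 1.\<close>

lemma det_four_block_mat_symmetric:
  fixes A B :: "'a :: idom mat"
  assumes A: "A \<in> carrier_mat n n" and B: "B \<in> carrier_mat n n"
  shows "det (four_block_mat A B B A) = det (A + B) * det (A - B)"
proof -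
  let ?I = "1\<^sub>m n :: 'a mat" and ?Z = "0\<^sub>m n n :: 'a mat"
  let ?U = "four_block_mat ?I ?I ?Z ?I" and ?V = "four_block_mat ?I (- ?I) ?Z ?I"
  have I: "?I \<in> carrier_mat n n" "- ?I \<in> carrier_mat n n" and Z: "?Z \<in> carrier_mat n n"
    by auto
  have U: "?U \<in> carrier_mat (n + n) (n + n)" and V: "?V \<in> carrier_mat (n + n) (n + n)"
    and M: "four_block_mat A B B A \<in> carrier_mat (n + n) (n + n)"
    using A B by auto
  have "?U * four_block_mat A B B A = four_block_mat (A + B) (B + A) B A"
    using A B by (subst mult_four_block_mat[OF I(1) I(1) Z I(1) A B B A]) auto
  also have "\<dots> * ?V = four_block_mat (A + B) ?Z B (A - B)"
    using A B
    by (subst mult_four_block_mat[where ?nr1.0 = n and ?nr2.0 = n and ?n1.0 = n and ?n2.0 = n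
          and ?nc1.0 = n and ?nc2.0 = n]) (auto intro!: eq_matI)
  finally have "?U * four_block_mat A B B A * ?V = four_block_mat (A + B) ?Z B (A - B)" .
  moreover have "det ?U = 1" "det ?V = 1"
    using det_four_block_mat_lower_left_zero[OF I(1) I(1) refl I(1)]
      det_four_block_mat_lower_left_zero[OF I(1) I(2) refl I(1)] by auto
  moreover have "det (four_block_mat (A + B) ?Z B (A - B)) = det (A + B) * det (A - B)"
    using A B by (intro det_four_block_mat_upper_right_zero) auto
  ultimately show ?thesis
    using det_mult[OF mult_carrier_mat[OF U M] V] det_mult[OF U M] by simp
qed

text \<open>Subtracting row 0 from all other rows confines \<open>x\<close> to row 0, and expanding
  along that row is affine in \<open>x\<close>. The slope stays anonymous because it is eliminated
  later.\<close>

lemma det_add_const_affine: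
  fixes a :: "nat \<Rightarrow> nat \<Rightarrow> 'a :: comm_ring_1"
  shows "\<exists>c. \<forall>x. det (mat n n (\<lambda>(i, j). a i j + x)) = det (mat n n (\<lambda>(i, j). a i j)) + x * c"
proof (cases "n = 0")
  case True
  then show ?thesis by (auto intro!: exI[of _ 0])
next
  case False
  then have n: "0 < n" by simp
  define L :: "'a mat"
    where "L = mat n n (\<lambda>(i, j). if i = j then 1 else if j = 0 then - 1 else 0)"
  define N where "N x = mat n n (\<lambda>(i, j). if i = 0 then a 0 j + x else a i j - a 0 j)" for x
  define C where "C j = cofactor (N 0) 0 j" for j
  have L: "L \<in> carrier_mat n n" and N: "N x \<in> carrier_mat n n" for x
    by (simp_all add: L_def N_def)
  have "det L = prod_list (diag_mat L)"
    by (rule det_lower_triangular[OF _ L]) (auto simp: L_def)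
  then have det_L: "det L = 1"
    by (simp add: prod_list_diag_prod L_def)
  have "L * mat n n (\<lambda>(i, j). a i j + x) = N x" for x
  proof (rule eq_matI)
    fix i j assume "i < dim_row (N x)" "j < dim_col (N x)"
    then have ij: "i < n" "j < n" by (auto simp: N_def)
    have "(L * mat n n (\<lambda>(i, j). a i j + x)) $$ (i, j)
        = (\<Sum>k = 0..<n. (if i = k then 1 else if k = 0 then - 1 else 0) * (a k j + x))"
      using ij by (simp add: L_def scalar_prod_def)
    \<comment> \<open>The term \<open>k = 0\<close> vanishes for \<open>i = 0\<close>, where the
      first summand already gives the diagonal entry 1 of \<open>L\<close>.\<close>
    also have "\<dots> = (\<Sum>k = 0..<n. (if k = i then a k j + x else 0)
        + (if k = 0 then if i = 0 then 0 else - (a k j + x) else 0))"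
      by (rule sum.cong) auto
    also have "\<dots> = N x $$ (i, j)"
      using ij n by (simp add: sum.distrib N_def)
    finally show "(L * mat n n (\<lambda>(i, j). a i j + x)) $$ (i, j) = N x $$ (i, j)" .
  qed (auto simp: L_def N_def)
  then have det_N: "det (mat n n (\<lambda>(i, j). a i j + x)) = det (N x)" for x
    using det_mult[OF L, of "mat n n (\<lambda>(i, j). a i j + x)"] det_L by simp
  \<comment> \<open>Deleting row 0 removes every occurrence of \<open>x\<close>.\<close>
  have "cofactor (N x) 0 j = C j" for x j
    unfolding C_def cofactor_def mat_delete_def N_def
    by (intro arg_cong2[where f = "(*)"] arg_cong[where f = det] refl eq_matI) auto
  then have "det (N x) = (\<Sum>j<n. (a 0 j + x) * C j)" for x
    using laplace_expansion_row[OF N n, of x] n by (simp add: N_def)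
  then have det_N': "det (N x) = det (N 0) + x * (\<Sum>j<n. C j)" for x
    by (simp add: distrib_right sum.distrib sum_distrib_left)
  have "det (mat n n (\<lambda>(i, j). a i j + x)) = det (mat n n (\<lambda>(i, j). a i j)) + x * (\<Sum>j<n. C j)" for x
    using det_N[of x] det_N[of 0] det_N'[of x] by simp
  then show ?thesis by blast
qed

text \<open>Rows and columns each contribute the sign of \<open>p\<close>, and its square is 1.
  Columns are treated as rows of the transpose.\<close>

lemma det_permute_rows_cols:
  fixes A :: "'a :: comm_ring_1 mat"
  assumes A: "A \<in> carrier_mat n n" and p: "p permutes {0..<n}"
  shows "det (mat n n (\<lambda>(i, j). A $$ (p i, p j))) = det A"
proof -
  define B where "B = mat n n (\<lambda>(i, j). A\<^sup>T $$ (p i, j))"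
  have pn: "p i < n" if "i < n" for i
    using permutes_in_image[OF p, of i] that by simp
  have "mat n n (\<lambda>(i, j). A $$ (p i, p j)) = mat n n (\<lambda>(i, j). B\<^sup>T $$ (p i, j))"
    using A pn by (intro eq_matI) (auto simp: B_def)
  also have "det \<dots> = signof p * det (B\<^sup>T)"
    by (rule det_permute_rows[OF _ p]) (simp add: B_def)
  also have "det (B\<^sup>T) = det B"
    by (rule det_transpose[of _ n]) (simp add: B_def)
  also have "det B = signof p * det (A\<^sup>T)"
    unfolding B_def using A by (intro det_permute_rows[OF _ p]) simp
  also have "det (A\<^sup>T) = det A"
    by (rule det_transpose[OF A])
  finally show ?thesis
    by (auto simp: sign_def split: if_splits)
qed

lemma hankel_det_double:
  "hankel_det s (2 * n) = det (four_block_mat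
      (mat n n (\<lambda>(a, b). s (2 * (a + b)))) (mat n n (\<lambda>(a, b). s (2 * (a + b) + 1)))
      (mat n n (\<lambda>(a, b). s (2 * (a + b) + 1))) (mat n n (\<lambda>(a, b). s (2 * (a + b + 1)))))"
proof -
  \<comment> \<open>\<open>p\<close> lists the even indices below \<open>2 * n\<close> first, then
    the odd ones, and is the identity beyond, as \<open>permutes\<close> demands.\<close>
  define p where "p i = (if i < n then 2 * i else if i < 2 * n then 2 * (i - n) + 1 else i)" for i
  have "inj_on p {0..<2 * n}"
    unfolding inj_on_def p_def by (auto split: if_splits; presburger)
  moreover have "p ` {0..<2 * n} \<subseteq> {0..<2 * n}"
    by (auto simp: p_def)
  ultimately have "bij_betw p {0..<2 * n} {0..<2 * n}"
    by (simp add: bij_betw_def endo_inj_surj)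
  then have p: "p permutes {0..<2 * n}"
    by (rule bij_imp_permutes) (auto simp: p_def)
  have "hankel_det s (2 * n) = det (mat (2 * n) (2 * n) (\<lambda>(i, j). hankel_mat s (2 * n) $$ (p i, p j)))"
    unfolding hankel_det_def
    by (rule det_permute_rows_cols[OF _ p, symmetric]) (simp add: hankel_mat_def)
  also have "mat (2 * n) (2 * n) (\<lambda>(i, j). hankel_mat s (2 * n) $$ (p i, p j)) = four_block_mat
      (mat n n (\<lambda>(a, b). s (2 * (a + b)))) (mat n n (\<lambda>(a, b). s (2 * (a + b) + 1)))
      (mat n n (\<lambda>(a, b). s (2 * (a + b) + 1))) (mat n n (\<lambda>(a, b). s (2 * (a + b + 1))))"
    by (rule eq_matI) (auto simp: hankel_mat_def p_def intro!: arg_cong[where f = s])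
  finally show ?thesis .
qed

lemma pd_double: "pd (2 * n) = 1" "pd (2 * n + 1) = 1 - pd n"
proof -
  \<comment> \<open>\<open>pd_letter\<close> treats every value other than 1 alike, so the letter at
    \<open>n\<close> can be recovered only once it is known to be 0 or 1.\<close>
  have range: "pd m = 0 \<or> pd m = 1" for m
  proof -
    have "set (pd_morph w) \<subseteq> {0, 1}" for w
      by (auto simp: pd_morph_def pd_letter_def)
    then have "set (map pd [0..<2 * Suc m]) \<subseteq> {0, 1}"
      using pd_fixed_point[of "Suc m"] by metis
    moreover have "pd m \<in> set (map pd [0..<2 * Suc m])"
      unfolding set_map by (rule imageI) (simp del: upt_Suc)
    ultimately show ?thesis by blast
  qed
  have "map pd [0..<2 * n] @ [pd (2 * n), pd (2 * n + 1)] = pd_morph (map pd [0..<Suc n])"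
    by (simp add: pd_fixed_point del: upt_Suc) simp
  also have "\<dots> = map pd [0..<2 * n] @ pd_letter (pd n)"
    by (simp add: pd_morph_append pd_fixed_point) (simp add: pd_morph_def)
  finally have "[pd (2 * n), pd (2 * n + 1)] = pd_letter (pd n)"
    by simp
  then show "pd (2 * n) = 1" "pd (2 * n + 1) = 1 - pd n"
    using range[of n] by (auto simp: pd_letter_def split: if_splits)
qed

text \<open>The pair of determinants is closed under doubling the order. The signs
  \<open>(- 1) ^ n\<close> come from negating matrices of order \<open>n\<close>.\<close>

lemma hankel_det_pd_double:
  "hankel_det pd (2 * n)
    = hankel_det pd n * (2 * hankel_det pd_compl n - (- 1) ^ n * hankel_det pd n)"
  "hankel_det pd_compl (2 * n) = (- 1) ^ n * (hankel_det pd n)\<^sup>2"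
proof -
  let ?D = "hankel_mat pd n"
  define T where "T x = mat n n (\<lambda>(i, j). pd (i + j) + x)" for x
  obtain c where "\<forall>x. det (T x) = det (mat n n (\<lambda>(i, j). pd (i + j))) + x * c"
    using det_add_const_affine[of n "\<lambda>i j. pd (i + j)"] unfolding T_def by blast
  then have T: "det (T x) = hankel_det pd n + x * c" for x
    by (simp add: hankel_det_def hankel_mat_def)
  have neg: "det ((- 1) \<cdot>\<^sub>m A) = (- 1) ^ n * det A" if "A \<in> carrier_mat n n" for A :: "int mat"
    using that by simp
  have "hankel_mat pd_compl n = (- 1) \<cdot>\<^sub>m T (- 1)"
    by (rule eq_matI) (auto simp: hankel_mat_def pd_compl_def T_def)
  then have compl: "hankel_det pd_compl n = (- 1) ^ n * (hankel_det pd n - c)"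
    using neg[of "T (- 1)"] T[of "- 1"] by (simp add: hankel_det_def T_def)

  \<comment> \<open>Even positions of the sequence give \<open>?J\<close>, odd ones give
    \<open>?E\<close>, which is \<open>?J - ?D\<close>.\<close>
  let ?J = "mat n n (\<lambda>_. 1) :: int mat" and ?E = "hankel_mat pd_compl n"
  have "hankel_det pd (2 * n) = det (four_block_mat ?J ?E ?E ?J)"
    unfolding hankel_det_double pd_double hankel_mat_def pd_compl_def
    by (simp add: case_prod_beta')
  also have "\<dots> = det (?J + ?E) * det (?J - ?E)"
    by (rule det_four_block_mat_symmetric) (auto simp: hankel_mat_def)
  also have "?J + ?E = (- 1) \<cdot>\<^sub>m T (- 2)"
    by (rule eq_matI) (auto simp: hankel_mat_def pd_compl_def T_def)
  also have "det \<dots> = (- 1) ^ n * (hankel_det pd n - 2 * c)"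
    using neg[of "T (- 2)"] T[of "- 2"] by (simp add: T_def)
  also have "?J - ?E = ?D"
    by (rule eq_matI) (auto simp: hankel_mat_def pd_compl_def)
  finally show "hankel_det pd (2 * n)
      = hankel_det pd n * (2 * hankel_det pd_compl n - (- 1) ^ n * hankel_det pd n)"
    \<comment> \<open>The slope drops out, since \<open>d - 2 * c = 2 * (d - c) - d\<close> for
      \<open>d = hankel_det pd n\<close>.\<close>
    unfolding compl by (simp add: hankel_det_def[symmetric] algebra_simps)

  have "hankel_det pd_compl (2 * n) = det (four_block_mat (0\<^sub>m n n) ?D ?D (0\<^sub>m n n))"
    unfolding hankel_det_double pd_double pd_compl_def hankel_mat_def
    by (simp add: zero_mat_def case_prod_beta')
  also have "\<dots> = det (0\<^sub>m n n + ?D) * det (0\<^sub>m n n - ?D)"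
    by (rule det_four_block_mat_symmetric) (auto simp: hankel_mat_def)
  also have "0\<^sub>m n n + ?D = ?D"
    by (rule left_add_zero_mat) (simp add: hankel_mat_def)
  also have "0\<^sub>m n n - ?D = (- 1) \<cdot>\<^sub>m ?D"
    by (rule eq_matI) (auto simp: hankel_mat_def)
  also have "det \<dots> = (- 1) ^ n * det ?D"
    by (rule neg) (simp add: hankel_mat_def)
  finally show "hankel_det pd_compl (2 * n) = (- 1) ^ n * (hankel_det pd n)\<^sup>2"
    by (simp add: hankel_det_def power2_eq_square)
qed

lemma jacobsthal_rec: "jacobsthal (k + 2) = jacobsthal (k + 1) + 2 * jacobsthal k"
  using three_jacobsthal[of k] three_jacobsthal[of "k + 1"] three_jacobsthal[of "k + 2"] by simp

theorem theorem1:
  fixes k :: nat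
  assumes "k \<ge> 2"
  shows "hankel_det pd (2 ^ k)
           = - jacobsthal (k + 1) * (\<Prod>i\<in>{3..k}. jacobsthal i ^ (2 ^ (k - i)))
       \<and> hankel_det pd_compl (2 ^ k)
           = jacobsthal k * (\<Prod>i\<in>{3..k}. jacobsthal i ^ (2 ^ (k - i)))"
  using assms
proof (induction k rule: dec_induct)
  case base
  \<comment> \<open>Order 4 is reached by doubling twice from order 1, the only odd order and hence
    the only one with sign -1.\<close>
  have "hankel_det pd 1 = 1" "hankel_det pd_compl 1 = 0"
    using det_single[of "hankel_mat pd 1"] det_single[of "hankel_mat pd_compl 1"]
    by (simp_all add: hankel_det_def hankel_mat_def pd_compl_def pd_0)
  then have "hankel_det pd 2 = 1" "hankel_det pd_compl 2 = - 1"
    using hankel_det_pd_double[of 1] by simp_all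
  then have "hankel_det pd 4 = - 3" "hankel_det pd_compl 4 = 1"
    using hankel_det_pd_double[of 2] by simp_all
  then show ?case
    by (simp add: jacobsthal_def)
next
  case (step k)
  define P where "P k = (\<Prod>i\<in>{3..k}. jacobsthal i ^ (2 ^ (k - i)))" for k
  have "P (Suc k) = jacobsthal (Suc k) * (\<Prod>i\<in>{3..k}. jacobsthal i ^ (2 ^ (Suc k - i)))"
    using step.hyps by (simp add: P_def prod.nat_ivl_Suc')
  \<comment> \<open>Passing from \<open>k\<close> to \<open>Suc k\<close> doubles each
    exponent.\<close>
  also have "(\<Prod>i\<in>{3..k}. jacobsthal i ^ (2 ^ (Suc k - i))) = (P k)\<^sup>2"
    unfolding P_def prod_power_distrib
    by (rule prod.cong) (simp_all add: Suc_diff_le power_mult[symmetric] mult.commute)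
  finally have P: "P (Suc k) = jacobsthal (Suc k) * (P k)\<^sup>2" .
  have "even (2 ^ k :: nat)"
    using step.hyps by simp
  then have double: "hankel_det pd (2 * 2 ^ k)
      = hankel_det pd (2 ^ k) * (2 * hankel_det pd_compl (2 ^ k) - hankel_det pd (2 ^ k))"
    "hankel_det pd_compl (2 * 2 ^ k) = (hankel_det pd (2 ^ k))\<^sup>2"
    using hankel_det_pd_double[of "2 ^ k"] by simp_all
  \<comment> \<open>With J for \<open>jacobsthal\<close>, the first determinant becomes
    \<open>- J (k + 1) * P k * (2 * J k + J (k + 1)) * P k\<close>, where the bracket is
    \<open>J (k + 2)\<close>; the second becomes \<open>(J (k + 1) * P k)\<^sup>2\<close>.\<close>
  show ?case
    using step.IH double jacobsthal_rec[of k]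
    unfolding P_def[symmetric] P
    by (simp add: power2_eq_square algebra_simps)
qed

end
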